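(* Let $X$ be a metric space. For arbitrary non-empty subsets $A, B\subset X$, we have $$d_H(A, B)\le \max\bigl\{d_H(A, X),\, d_H(B, X)\bigr\}.$$
   Context: For a metric space $X$ with distance $|xy|$, a point $x\in X$ and a non-empty subset $A\subset X$, put $\operatorname{d}(x,A)=\inf\{|xa| : a\in A\}$. For non-empty subsets $A,B\subset X$ the Hausdorff distance is $$d_H(A,B)=\inf\{r>0 : A\subset U_r(B),\ B\subset U_r(A)\}=\max\Bigl(\sup_{a\in A}\operatorname{d}(a,B),\ \sup_{b\in B}\operatorname{d}(b,A)\Bigr)\in[0,\infty],$$ where $U_r(A)$ is the open $r$-neighborhood of $A$. The value $+\infty$ is allowed. *)

theory Defs
  imports "HOL-Analysis.Analysis"
begin

context Metric_space
begin

definition nbhd :: "real \<Rightarrow> 'a set \<Rightarrow> 'a set" where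
  "nbhd r A = (\<Union>a\<in>A. mball a r)"

(* The infimum is taken in ennreal, so it is \<infinity> if no radius is admissible. *)
definition hausdist :: "'a set \<Rightarrow> 'a set \<Rightarrow> ennreal" where
  "hausdist A B = Inf {ennreal r | r. 0 < r \<and> A \<subseteq> nbhd r B \<and> B \<subseteq> nbhd r A}"

definition point_dist :: "'a \<Rightarrow> 'a set \<Rightarrow> ennreal" where
  "point_dist x A = (INF a\<in>A. ennreal (d x a))"

lemma point_dist_less_imp_nbhd:
  assumes "x \<in> M" "A \<subseteq> M" "point_dist x A < ennreal r"
  shows "x \<in> nbhd r A"
proof -
  obtain a where a: "a \<in> A" "ennreal (d x a) < ennreal r"
    using assms(3) by (auto simp: point_dist_def INF_less_iff)
  then have "d a x < r"
    by (simp add: ennreal_less_iff commute)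
  then show ?thesis
    using a(1) assms(1,2) by (auto simp: nbhd_def)
qed

lemma nbhd_imp_point_dist_le:
  assumes "x \<in> nbhd r A"
  shows "point_dist x A \<le> ennreal r"
proof -
  obtain a where a: "a \<in> A" "d a x < r"
    using assms by (auto simp: nbhd_def)
  have "point_dist x A \<le> ennreal (d x a)"
    unfolding point_dist_def using a(1) by (rule INF_lower)
  also have "\<dots> \<le> ennreal r"
    using a(2) by (intro ennreal_leI) (simp add: commute)
  finally show ?thesis .
qed

lemma hausdist_eq_max:
  assumes "A \<subseteq> M" "B \<subseteq> M"
  shows "hausdist A B = max (SUP a\<in>A. point_dist a B) (SUP b\<in>B. point_dist b A)"
    (is "_ = ?m")
proof (rule antisym)
  show "hausdist A B \<le> ?m"
  proof (rule dense_ge)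
    fix t assume "?m < t"
    then obtain s where s: "?m < s" "s < t"
      using dense by blast
    then obtain r where r: "s = ennreal r" "0 \<le> r"
      by (cases s) auto
    have "0 < r"
      using s(1) r by (cases "r = 0") auto
    moreover have "A \<subseteq> nbhd r B"
    proof
      fix a assume a: "a \<in> A"
      have le: "point_dist a B \<le> ?m"
        using a by (auto intro: SUP_upper le_max_iff_disj[THEN iffD2])
      then show "a \<in> nbhd r B"
        using order.strict_trans1[OF le s(1)] r(1) a assms
        by (intro point_dist_less_imp_nbhd) auto
    qed
    moreover have "B \<subseteq> nbhd r A"
    proof
      fix b assume b: "b \<in> B"
      have le: "point_dist b A \<le> ?m"
        using b by (auto intro: SUP_upper le_max_iff_disj[THEN iffD2])
      then show "b \<in> nbhd r A"
        using order.strict_trans1[OF le s(1)] r(1) b assms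
        by (intro point_dist_less_imp_nbhd) auto
    qed
    ultimately have "hausdist A B \<le> s"
      unfolding hausdist_def r(1) by (intro Inf_lower) auto
    then show "hausdist A B \<le> t"
      using s(2) by simp
  qed
  show "?m \<le> hausdist A B"
    unfolding hausdist_def
    by (rule Inf_greatest) (auto intro!: SUP_least nbhd_imp_point_dist_le)
qed

end

end

theory Submission
  imports Defs
begin

text \<open>By \<open>hausdist_eq_max\<close>, a Hausdorff distance is the larger of two one-sided
  excesses. Enlarging \<open>A\<close> to \<open>X\<close> can only increase the supremum of
  distances to \<open>B\<close>, and the enlarged supremum is one of the two excesses making up
  \<open>hausdist B X\<close>. The other excess is handled symmetrically, so no triangle inequality
  enters the estimate.\<close>

theorem proposition2:
  fixes X :: "'a set" and d :: "'a \<Rightarrow> 'a \<Rightarrow> real" and A B :: "'a set"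
  assumes "Metric_space X d"
    and "A \<subseteq> X" "A \<noteq> {}"
    and "B \<subseteq> X" "B \<noteq> {}"
  shows "Metric_space.hausdist X d A B
           \<le> max (Metric_space.hausdist X d A X) (Metric_space.hausdist X d B X)"
proof -
  interpret Metric_space X d by fact
  have "(SUP a\<in>A. point_dist a B) \<le> (SUP x\<in>X. point_dist x B)"
    using \<open>A \<subseteq> X\<close> by (rule SUP_subset_mono) simp
  also have "\<dots> \<le> hausdist B X"
    using \<open>B \<subseteq> X\<close> by (simp add: hausdist_eq_max)
  finally have A: "(SUP a\<in>A. point_dist a B) \<le> hausdist B X" .
  have "(SUP b\<in>B. point_dist b A) \<le> (SUP x\<in>X. point_dist x A)"
    using \<open>B \<subseteq> X\<close> by (rule SUP_subset_mono) simp
  also have "\<dots> \<le> hausdist A X"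
    using \<open>A \<subseteq> X\<close> by (simp add: hausdist_eq_max)
  finally have B: "(SUP b\<in>B. point_dist b A) \<le> hausdist A X" .
  show ?thesis
    unfolding hausdist_eq_max[OF \<open>A \<subseteq> X\<close> \<open>B \<subseteq> X\<close>]
    \<comment> \<open>The bounds cross over: the excess of \<open>A\<close> over \<open>B\<close>
      goes under the \<open>B\<close> entry of the right-hand maximum, that of \<open>B\<close> over
      \<open>A\<close> under the \<open>A\<close> entry.\<close>
    using A B by (auto simp only: max.bounded_iff le_max_iff_disj)
qed

end
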